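(* Let $J$ be an infinite index set. The metric compactification of $\ell_1(J)$ is given by $$\overline{\ell_{1}(J)}^{h}=\left\{h^{\{I,\varepsilon,z\}}\in\mathbb{R}^{\ell_{1}(J)} \;\middle|\; \emptyset\subseteq I\subseteq J,\ \varepsilon\in\{-1,+1\}^{I},\ z\in\mathbb{R}^{J\setminus I}\right\},$$ where for every $x\in\ell_1(J)$ $$h^{\{I,\varepsilon,z\}}(x)=\sum_{j\in I}\varepsilon(j)x(j)+\sum_{j\in J\setminus I}\left(|x(j)-z(j)|-|z(j)|\right).$$
   Context: $J$ is an infinite (countable or uncountable) index set. $\ell_1(J)$ is the real Banach space of all $x=(x(j))_{j\in J}\in\mathbb{R}^J$ with $\|x\|_1:=\sum_{j\in J}|x(j)|<\infty$, where the sum is the supremum over finite subsets of $J$ of the finite partial sums. Sums over (possibly uncountable) index sets in the formula for $h^{\{I,\varepsilon,z\}}$ are unconditional sums (limits of the net of finite partial sums, directed by inclusion); they converge absolutely because each term is bounded in absolute value by $|x(j)|$. Note that $z\in\mathbb{R}^{J\setminus I}$ is arbitrary (no summability is required), and $I$ may be empty or all of $J$. Metric compactification: for a Banach space $(X,\|\cdot\|)$ and $y\in X$, let $h_y:X\to\mathbb{R}$, $h_y(x)=\|x-y\|-\|y\|$. The metric compactification $\overline{X}^{h}$ of $X$ is the closure of $\{h_y\mid y\in X\}$ in $\mathbb{R}^X$ with the product topology (the topology of pointwise convergence). *)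

theory Defs
  imports "HOL-Analysis.Analysis"
begin

section \<open>The Banach space of absolutely summable real families\<close>

text \<open>
  The index set \<open>J\<close> is the universe of the type \<^typ>\<open>'j\<close>, of arbitrary cardinality.
\<close>

typedef 'j ell1 = "{x :: 'j \<Rightarrow> real. (\<lambda>j. \<bar>x j\<bar>) summable_on UNIV}"
  morphisms apply_ell1 Abs_ell1
  by (rule exI[of _ "\<lambda>_. 0"]) simp

setup_lifting type_definition_ell1

declare [[coercion "apply_ell1 :: 'j ell1 \<Rightarrow> 'j \<Rightarrow> real"]]

lemma ell1_eqI: "(\<And>j. apply_ell1 x j = apply_ell1 y j) \<Longrightarrow> x = y"
  by transfer auto

lemma abs_summable_apply_ell1: "(\<lambda>j. \<bar>apply_ell1 x j\<bar>) summable_on UNIV"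
  using apply_ell1[of x] by simp

lemma summable_on_abs_add:
  fixes f g :: "'j \<Rightarrow> real"
  assumes "(\<lambda>j. \<bar>f j\<bar>) summable_on A" "(\<lambda>j. \<bar>g j\<bar>) summable_on A"
  shows "(\<lambda>j. \<bar>f j + g j\<bar>) summable_on A"
proof (rule summable_on_comparison_test)
  show "(\<lambda>j. \<bar>f j\<bar> + \<bar>g j\<bar>) summable_on A"
    using assms by (rule summable_on_add)
qed (auto intro: abs_triangle_ineq)

instantiation ell1 :: (type) real_normed_vector
begin

lift_definition zero_ell1 :: "'a ell1" is "\<lambda>_. 0"
  by simp

lift_definition plus_ell1 :: "'a ell1 \<Rightarrow> 'a ell1 \<Rightarrow> 'a ell1" is "\<lambda>x y j. x j + y j"
  by (rule summable_on_abs_add)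

lift_definition uminus_ell1 :: "'a ell1 \<Rightarrow> 'a ell1" is "\<lambda>x j. - x j"
  by simp

lift_definition minus_ell1 :: "'a ell1 \<Rightarrow> 'a ell1 \<Rightarrow> 'a ell1" is "\<lambda>x y j. x j - y j"
proof -
  fix x y :: "'a \<Rightarrow> real"
  assume "(\<lambda>j. \<bar>x j\<bar>) summable_on UNIV" "(\<lambda>j. \<bar>y j\<bar>) summable_on UNIV"
  then show "(\<lambda>j. \<bar>x j - y j\<bar>) summable_on UNIV"
    using summable_on_abs_add[of x UNIV "\<lambda>j. - y j"] by simp
qed

lift_definition scaleR_ell1 :: "real \<Rightarrow> 'a ell1 \<Rightarrow> 'a ell1" is "\<lambda>c x j. c * x j"
  by (auto simp: abs_mult intro: summable_on_cmult_right)

definition norm_ell1 :: "'a ell1 \<Rightarrow> real"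
  where "norm_ell1 x = (\<Sum>\<^sub>\<infinity>j. \<bar>apply_ell1 x j\<bar>)"

definition sgn_ell1 :: "'a ell1 \<Rightarrow> 'a ell1"
  where "sgn_ell1 x = inverse (norm x) *\<^sub>R x"

definition dist_ell1 :: "'a ell1 \<Rightarrow> 'a ell1 \<Rightarrow> real"
  where "dist_ell1 x y = norm (x - y)"

definition uniformity_ell1 :: "('a ell1 \<times> 'a ell1) filter"
  where "uniformity_ell1 = (INF e\<in>{0<..}. principal {(x, y). dist x y < e})"

definition open_ell1 :: "'a ell1 set \<Rightarrow> bool"
  where "open_ell1 U = (\<forall>x\<in>U. \<forall>\<^sub>F (x', y) in uniformity. x' = x \<longrightarrow> y \<in> U)"

instance
proof
  fix x y z :: "'a ell1" and a b :: real
  note rep = plus_ell1.rep_eq zero_ell1.rep_eq uminus_ell1.rep_eq minus_ell1.rep_eq scaleR_ell1.rep_eq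
  show "x + y + z = x + (y + z)" "x + y = y + x" "0 + x = x" "- x + x = 0" "x - y = x + - y"
    by (rule ell1_eqI; simp add: rep algebra_simps)+
  show "a *\<^sub>R (x + y) = a *\<^sub>R x + a *\<^sub>R y" "(a + b) *\<^sub>R x = a *\<^sub>R x + b *\<^sub>R x"
    "a *\<^sub>R b *\<^sub>R x = (a * b) *\<^sub>R x" "1 *\<^sub>R x = x"
    by (rule ell1_eqI; simp add: rep algebra_simps)+
  show "dist x y = norm (x - y)" by (fact dist_ell1_def)
  show "sgn x = inverse (norm x) *\<^sub>R x" by (fact sgn_ell1_def)
  show "uniformity = (INF e\<in>{0<..}. principal {(x :: 'a ell1, y). dist x y < e})"
    by (fact uniformity_ell1_def)
  show "open U \<longleftrightarrow> (\<forall>x\<in>U. \<forall>\<^sub>F (x', y) in uniformity. x' = x \<longrightarrow> y \<in> U)" for U :: "'a ell1 set"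
    by (fact open_ell1_def)
  show "norm x = 0 \<longleftrightarrow> x = 0"
  proof
    assume *: "norm x = 0"
    have "\<bar>apply_ell1 x j\<bar> = 0" for j
      by (rule nonneg_infsum_le_0D[of "\<lambda>j. \<bar>apply_ell1 x j\<bar>" UNIV])
        (use * abs_summable_apply_ell1[of x] in \<open>auto simp: norm_ell1_def\<close>)
    then show "x = 0"
      by (intro ell1_eqI) (simp add: zero_ell1.rep_eq)
  qed (simp add: norm_ell1_def zero_ell1.rep_eq)
  show "norm (x + y) \<le> norm x + norm y"
  proof -
    have "norm (x + y) \<le> (\<Sum>\<^sub>\<infinity>j. \<bar>apply_ell1 x j\<bar> + \<bar>apply_ell1 y j\<bar>)"
      unfolding norm_ell1_def
      by (intro infsum_mono abs_summable_apply_ell1 summable_on_add)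
        (simp add: plus_ell1.rep_eq abs_triangle_ineq)
    also have "\<dots> = norm x + norm y"
      unfolding norm_ell1_def by (intro infsum_add abs_summable_apply_ell1)
    finally show ?thesis .
  qed
  show "norm (a *\<^sub>R x) = \<bar>a\<bar> * norm x"
    by (simp add: norm_ell1_def scaleR_ell1.rep_eq abs_mult infsum_cmult_right')
qed

end

lemma norm_ell1_eq_SUP:
  "norm x = (SUP F\<in>{F. finite F}. \<Sum>j\<in>F. \<bar>apply_ell1 x j\<bar>)"
  unfolding norm_ell1_def
  using infsum_nonneg_is_SUPREMUM_real[OF abs_summable_apply_ell1[of x]] by simp

lemma sum_abs_le_norm_ell1: "finite F \<Longrightarrow> (\<Sum>j\<in>F. \<bar>apply_ell1 x j\<bar>) \<le> norm x"
  unfolding norm_ell1_def by (intro finite_sum_le_infsum abs_summable_apply_ell1) auto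

lemma norm_ell1_le:
  assumes "\<And>F. finite F \<Longrightarrow> (\<Sum>j\<in>F. \<bar>apply_ell1 x j\<bar>) \<le> b"
  shows "norm x \<le> b"
  unfolding norm_ell1_def using assms by (intro infsum_le_finite_sums abs_summable_apply_ell1)

instance ell1 :: (type) banach
proof
  fix X :: "nat \<Rightarrow> 'a ell1"
  assume X: "Cauchy X"
  have coord: "\<bar>apply_ell1 x j - apply_ell1 y j\<bar> \<le> dist x y" for x y :: "'a ell1" and j
    using sum_abs_le_norm_ell1[of "{j}" "x - y"] by (simp add: dist_norm minus_ell1.rep_eq)
  have "Cauchy (\<lambda>n. apply_ell1 (X n) j)" for j
    using X coord unfolding Cauchy_def dist_real_def by (meson le_less_trans)
  then obtain l where l: "\<And>j. (\<lambda>n. apply_ell1 (X n) j) \<longlonglongrightarrow> l j"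
    unfolding Cauchy_convergent_iff convergent_def by metis
  have tail: "\<exists>N. \<forall>n\<ge>N. \<forall>F. finite F \<longrightarrow> (\<Sum>j\<in>F. \<bar>apply_ell1 (X n) j - l j\<bar>) \<le> e"
    if "e > 0" for e
  proof -
    obtain N where N: "\<And>m n. m \<ge> N \<Longrightarrow> n \<ge> N \<Longrightarrow> dist (X m) (X n) < e"
      using X \<open>e > 0\<close> unfolding Cauchy_def by blast
    have "(\<Sum>j\<in>F. \<bar>apply_ell1 (X n) j - l j\<bar>) \<le> e" if "n \<ge> N" "finite F" for n F
    proof (rule LIMSEQ_le_const2)
      show "(\<lambda>m. \<Sum>j\<in>F. \<bar>apply_ell1 (X n) j - apply_ell1 (X m) j\<bar>)
              \<longlonglongrightarrow> (\<Sum>j\<in>F. \<bar>apply_ell1 (X n) j - l j\<bar>)"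
        by (intro tendsto_intros l)
      have "(\<Sum>j\<in>F. \<bar>apply_ell1 (X n) j - apply_ell1 (X m) j\<bar>) \<le> e" if "m \<ge> N" for m
        using sum_abs_le_norm_ell1[of F "X n - X m"] N[OF \<open>n \<ge> N\<close> that] \<open>finite F\<close>
        by (simp add: dist_norm minus_ell1.rep_eq)
      then show "\<exists>M. \<forall>m\<ge>M. (\<Sum>j\<in>F. \<bar>apply_ell1 (X n) j - apply_ell1 (X m) j\<bar>) \<le> e"
        by blast
    qed
    then show ?thesis by blast
  qed
  obtain N where N: "\<And>F. finite F \<Longrightarrow> (\<Sum>j\<in>F. \<bar>apply_ell1 (X N) j - l j\<bar>) \<le> 1"
    using tail[of 1] by auto
  have "(\<lambda>j. \<bar>apply_ell1 (X N) j - l j\<bar>) summable_on UNIV"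
    by (intro nonneg_bdd_above_summable_on bdd_aboveI[of _ 1]) (auto intro: N)
  then have "(\<lambda>j. \<bar>l j - apply_ell1 (X N) j\<bar>) summable_on UNIV"
    by (simp only: abs_minus_commute)
  from summable_on_abs_add[OF this abs_summable_apply_ell1[of "X N"]]
  have "(\<lambda>j. \<bar>l j\<bar>) summable_on UNIV"
    by simp
  then obtain L where L: "apply_ell1 L = l"
    using Abs_ell1_inverse[of l] by blast
  have "X \<longlonglongrightarrow> L"
    unfolding LIMSEQ_iff
  proof (intro allI impI)
    fix r :: real
    assume "r > 0"
    then obtain N where N: "\<And>n F. n \<ge> N \<Longrightarrow> finite F \<Longrightarrow>
        (\<Sum>j\<in>F. \<bar>apply_ell1 (X n) j - l j\<bar>) \<le> r / 2"
      using tail[of "r / 2"] by auto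
    have "norm (X n - L) \<le> r / 2" if "n \<ge> N" for n
      by (rule norm_ell1_le) (use N[OF that] in \<open>simp add: minus_ell1.rep_eq L\<close>)
    with \<open>r > 0\<close> show "\<exists>N. \<forall>n\<ge>N. norm (X n - L) < r"
      by (intro exI[of _ N]) fastforce
  qed
  then show "convergent X" by (rule convergentI)
qed


section \<open>The metric compactification\<close>

definition metric_functional :: "'a::banach \<Rightarrow> 'a \<Rightarrow> real"
  where "metric_functional y x = norm (x - y) - norm y"

text \<open>
  The closure is taken in the instance of \<^class>\<open>topological_space\<close> for function types,
  that is, in the topology of pointwise convergence on \<^typ>\<open>'a \<Rightarrow> real\<close>.
\<close>

definition metric_compactification :: "('a::banach \<Rightarrow> real) set"
  where "metric_compactification = closure (range metric_functional)"


section \<open>The functionals indexed by \<open>I\<close>, \<open>\<epsilon>\<close> and \<open>z\<close>\<close>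

definition ell1_functional ::
    "'j set \<Rightarrow> ('j \<Rightarrow> real) \<Rightarrow> ('j \<Rightarrow> real) \<Rightarrow> 'j ell1 \<Rightarrow> real"
  where "ell1_functional I \<epsilon> z x =
    (\<Sum>\<^sub>\<infinity>j\<in>I. \<epsilon> j * x j) + (\<Sum>\<^sub>\<infinity>j\<in>UNIV - I. \<bar>x j - z j\<bar> - \<bar>z j\<bar>)"

text \<open>
  \<^const>\<open>infsum\<close> is \<open>0\<close> by convention on families that are not summable; the following
  shows that this convention is never used in \<^const>\<open>ell1_functional\<close>.
\<close>

lemma ell1_functional_summable:
  assumes "\<epsilon> \<in> I \<rightarrow>\<^sub>E {-1, 1}"
  shows "(\<lambda>j. \<bar>\<epsilon> j * apply_ell1 x j\<bar>) summable_on I"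
    and "(\<lambda>j. \<bar>\<bar>apply_ell1 x j - z j\<bar> - \<bar>z j\<bar>\<bar>) summable_on (UNIV - I)"
proof -
  have *: "(\<lambda>j. \<bar>apply_ell1 x j\<bar>) summable_on A" for A
    by (rule summable_on_subset_banach[OF abs_summable_apply_ell1]) simp
  show "(\<lambda>j. \<bar>\<epsilon> j * apply_ell1 x j\<bar>) summable_on I"
  proof (rule summable_on_comparison_test[OF *[of I]])
    fix j assume "j \<in> I"
    with assms have "\<epsilon> j \<in> {-1, 1}" by (rule PiE_mem)
    then show "\<bar>\<epsilon> j * apply_ell1 x j\<bar> \<le> \<bar>apply_ell1 x j\<bar>" by auto
  qed auto
  show "(\<lambda>j. \<bar>\<bar>apply_ell1 x j - z j\<bar> - \<bar>z j\<bar>\<bar>) summable_on (UNIV - I)"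
    by (rule summable_on_comparison_test[OF *[of "UNIV - I"]]) auto
qed

end

theory Submission
  imports Defs
begin

text \<open>
  For a single coordinate, the functional \<open>\<lambda>t. \<bar>t - r\<bar> - \<bar>r\<bar>\<close> of a real number \<open>r\<close> converges
  pointwise to \<open>\<lambda>t. - t\<close> as \<open>r\<close> tends to \<open>\<infinity>\<close>, and to \<open>\<lambda>t. t\<close> as \<open>r\<close> tends to \<open>- \<infinity>\<close>.
  Hence it extends to a function \<^term>\<open>line_functional\<close> of an extended real parameter, continuous
  in that parameter. A choice of an extended real parameter for every index \<open>j\<close> is the same as a
  triple \<open>(I, \<epsilon>, z)\<close>: the set \<open>I\<close> collects the coordinates with an infinite parameter, \<open>\<epsilon> j\<close> is
  the negative of the sign of that infinity, and \<open>z\<close> lists the finite parameters. So the functionals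
  on the right-hand side of the theorem are exactly the sums over all coordinates
  \<^term>\<open>extended_functional a\<close> with \<open>a\<close> in \<open>[- \<infinity>, \<infinity>]\<^sup>J\<close>
  (lemma \<open>range_extended_functional\<close>), while the functionals of the points of the space \<open>l\<^sub>1(J)\<close>
  are those with \<open>a\<close> a summable real family.

  The theorem is now a statement about the map \<open>a \<mapsto> extended_functional a\<close>, and three facts
  settle it. The map is continuous for the product topologies, because at a fixed \<open>x\<close> the terms
  of the sum are dominated by the summable family \<open>\<bar>x j\<bar>\<close>, whatever \<open>a\<close> is
  (lemma \<open>continuous_on_extended_functional\<close>). Its domain \<open>[- \<infinity>, \<infinity>]\<^sup>J\<close> is compact by Tychonoff's
  theorem, so its range is closed and contains the metric compactification. Finally, summable
  real families are dense in \<open>[- \<infinity>, \<infinity>]\<^sup>J\<close> (lemma \<open>closure_ell1_in_ereal_fun\<close>), so by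
  continuity the range lies in the closure of the functionals of points.
\<close>

section \<open>One coordinate: the metric compactification of the real line\<close>

text \<open>
  Moving \<open>a\<close> to the nearest point of the interval from \<open>- \<bar>t\<bar>\<close> to \<open>\<bar>t\<bar>\<close> does not
  change \<open>\<bar>t - a\<bar> - \<bar>a\<bar>\<close> for real \<open>a\<close>, since this quantity is constant in \<open>a\<close> on either side of
  that interval. The truncated parameter is always finite, so a single formula covers the infinite
  parameters too and exhibits the continuous dependence on \<open>a\<close>.
\<close>

definition line_functional :: "ereal \<Rightarrow> real \<Rightarrow> real"
  where "line_functional a t =
    (let c = real_of_ereal (max (ereal (- \<bar>t\<bar>)) (min a (ereal \<bar>t\<bar>))) in \<bar>t - c\<bar> - \<bar>c\<bar>)"

lemma line_functional_ereal: "line_functional (ereal r) t = \<bar>t - r\<bar> - \<bar>r\<bar>"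
proof -
  have "max (ereal (- \<bar>t\<bar>)) (min (ereal r) (ereal \<bar>t\<bar>)) =
      ereal (if r < - \<bar>t\<bar> then - \<bar>t\<bar> else if \<bar>t\<bar> < r then \<bar>t\<bar> else r)"
    by (simp add: max_def min_def) linarith
  then show ?thesis
    unfolding line_functional_def Let_def by simp
qed

lemma line_functional_infinity:
  "line_functional \<infinity> t = - t"
  "line_functional (- \<infinity>) t = t"
  by (simp_all add: line_functional_def Let_def min_def max_def)

lemma abs_line_functional_le: "\<bar>line_functional a t\<bar> \<le> \<bar>t\<bar>"
  by (cases a) (auto simp: line_functional_ereal line_functional_infinity)

lemma continuous_on_line_functional: "continuous_on UNIV (\<lambda>a. line_functional a t)"
proof -
  let ?c = "\<lambda>a. max (ereal (- \<bar>t\<bar>)) (min a (ereal \<bar>t\<bar>))"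
  have c: "?c a \<in> UNIV - {\<infinity>, - \<infinity>}" for a
    by (cases a) (simp_all add: max_def min_def)
  have "continuous_on UNIV ?c"
    by (intro continuous_intros)
  then have "continuous_on UNIV (\<lambda>a. real_of_ereal (?c a))"
    by (rule continuous_on_compose2[OF continuous_on_real]) (use c in auto)
  then show ?thesis
    unfolding line_functional_def Let_def by (intro continuous_intros)
qed

section \<open>Families of extended real parameters\<close>

definition extended_functional :: "('j \<Rightarrow> ereal) \<Rightarrow> 'j ell1 \<Rightarrow> real"
  where "extended_functional a x = (\<Sum>\<^sub>\<infinity>j. line_functional (a j) (apply_ell1 x j))"

lemma metric_functional_eq_extended_functional:
  "metric_functional y = extended_functional (\<lambda>j. ereal (apply_ell1 y j))"
proof
  fix x
  have "metric_functional y x = (\<Sum>\<^sub>\<infinity>j. \<bar>apply_ell1 (x - y) j\<bar>) + (\<Sum>\<^sub>\<infinity>j. - \<bar>apply_ell1 y j\<bar>)"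
    by (simp add: metric_functional_def norm_ell1_def infsum_uminus)
  also have "\<dots> = (\<Sum>\<^sub>\<infinity>j. \<bar>apply_ell1 (x - y) j\<bar> + - \<bar>apply_ell1 y j\<bar>)"
    by (rule infsum_add[symmetric]) (simp_all only: summable_on_uminus abs_summable_apply_ell1)
  also have "\<dots> = extended_functional (\<lambda>j. ereal (apply_ell1 y j)) x"
    by (simp add: extended_functional_def line_functional_ereal minus_ell1.rep_eq)
  finally show "metric_functional y x = \<dots>" .
qed

text \<open>
  The signs are opposite because \<open>line_functional \<infinity> t = - t\<close>: a point escaping to \<open>\<infinity>\<close> in a
  coordinate sees the distance shrink as that coordinate of \<open>x\<close> grows.
\<close>

lemma ell1_functional_eq_extended_functional:
  assumes "\<epsilon> \<in> I \<rightarrow>\<^sub>E {-1, 1}"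
  shows "ell1_functional I \<epsilon> z =
    extended_functional (\<lambda>j. if j \<in> I then (if \<epsilon> j = 1 then - \<infinity> else \<infinity>) else ereal (z j))"
    (is "_ = extended_functional ?a")
proof
  fix x
  let ?g = "\<lambda>j. line_functional (?a j) (apply_ell1 x j)"
  have g_in: "?g j = \<epsilon> j * apply_ell1 x j" if "j \<in> I" for j
    using PiE_mem[OF assms that] that by (auto simp: line_functional_infinity)
  have g_out: "?g j = \<bar>apply_ell1 x j - z j\<bar> - \<bar>z j\<bar>" if "j \<in> UNIV - I" for j
    using that by (simp add: line_functional_ereal)
  have summable: "?g summable_on A" for A
    by (rule abs_summable_summable, rule summable_on_comparison_test
          [OF summable_on_subset_banach[OF abs_summable_apply_ell1[of x] subset_UNIV]])
       (auto intro: abs_line_functional_le)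
  have "ell1_functional I \<epsilon> z x = infsum ?g I + infsum ?g (UNIV - I)"
    unfolding ell1_functional_def using g_in g_out
    by (intro arg_cong2[of _ _ _ _ "(+)"] infsum_cong) auto
  also have "\<dots> = infsum ?g (I \<union> (UNIV - I))"
    by (rule infsum_Un_disjoint[symmetric]) (auto intro: summable)
  finally show "ell1_functional I \<epsilon> z x = extended_functional ?a x"
    by (simp add: extended_functional_def)
qed

lemma range_extended_functional:
  "range extended_functional = {ell1_functional I \<epsilon> z | I \<epsilon> z.
      I \<subseteq> UNIV \<and> \<epsilon> \<in> I \<rightarrow>\<^sub>E {-1, 1} \<and> z \<in> (UNIV - I) \<rightarrow>\<^sub>E UNIV}"
  (is "_ = ?R")
proof
  show "?R \<subseteq> range extended_functional"
    by (auto simp: ell1_functional_eq_extended_functional)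
  show "range extended_functional \<subseteq> ?R"
  proof (rule image_subsetI)
    fix a :: "'a \<Rightarrow> ereal"
    define I where "I = {j. \<bar>a j\<bar> = \<infinity>}"
    define \<epsilon> :: "'a \<Rightarrow> real" where "\<epsilon> = (\<lambda>j\<in>I. if a j = \<infinity> then - 1 else 1)"
    define z where "z = (\<lambda>j\<in>UNIV - I. real_of_ereal (a j))"
    have \<epsilon>: "\<epsilon> \<in> I \<rightarrow>\<^sub>E {-1, 1}"
      by (auto simp: \<epsilon>_def)
    have "a j = (if j \<in> I then (if \<epsilon> j = 1 then - \<infinity> else \<infinity>) else ereal (z j))" for j
      by (cases "a j") (auto simp: I_def \<epsilon>_def z_def)
    then have "extended_functional a = ell1_functional I \<epsilon> z"
      unfolding ell1_functional_eq_extended_functional[OF \<epsilon>] by presburger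
    moreover have "z \<in> (UNIV - I) \<rightarrow>\<^sub>E UNIV"
      by (auto simp: z_def)
    ultimately show "extended_functional a \<in> ?R"
      using \<epsilon> by blast
  qed
qed

section \<open>Continuity, compactness and density\<close>

text \<open>
  In the topology of pointwise convergence it suffices to fix \<open>x\<close>. The bound
  \<open>\<bar>line_functional (a j) (x j)\<bar> \<le> \<bar>x j\<bar>\<close> is uniform in \<open>a\<close>, so the Weierstrass M-test makes the
  finite partial sums, each continuous in finitely many coordinates of \<open>a\<close>, converge uniformly.
\<close>

lemma continuous_on_extended_functional: "continuous_on UNIV extended_functional"
proof (rule continuous_on_coordinatewise_then_product)
  fix x :: "'a ell1"
  let ?f = "\<lambda>j a. line_functional (a j) (apply_ell1 x j)"
  have "uniform_limit UNIV (\<lambda>F a. \<Sum>j\<in>F. ?f j a) (\<lambda>a. \<Sum>\<^sub>\<infinity>j. ?f j a) (finite_subsets_at_top UNIV)"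
    by (rule Weierstrass_m_test_general[where M = "\<lambda>j. \<bar>apply_ell1 x j\<bar>"])
       (simp_all add: abs_line_functional_le abs_summable_apply_ell1)
  moreover have "continuous_on UNIV (?f j)" for j
    by (rule continuous_on_compose2[OF continuous_on_line_functional]) auto
  then have "continuous_on UNIV (\<lambda>a. \<Sum>j\<in>F. ?f j a)" for F
    by (intro continuous_on_sum)
  ultimately show "continuous_on UNIV (\<lambda>a. extended_functional a x)"
    unfolding extended_functional_def
    by (intro uniform_limit_theorem[where F = "finite_subsets_at_top UNIV"]) auto
qed

lemma compact_UNIV_ereal_fun: "compact (UNIV :: ('j \<Rightarrow> ereal) set)"
proof -
  have "compact_space (euclidean :: ereal topology)"
    by (simp add: compact_space_def compact_UNIV)
  then have "compact_space (product_topology (\<lambda>_. euclidean) UNIV :: ('j \<Rightarrow> ereal) topology)"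
    by (simp add: compact_space_product_topology)
  then show ?thesis
    unfolding euclidean_product_topology by (simp add: compact_space_def)
qed

lemma open_ereal_contains_real:
  assumes "open (U :: ereal set)" "U \<noteq> {}"
  shows "\<exists>r. ereal r \<in> U"
proof -
  obtain a where "a \<in> U" using assms(2) by blast
  show ?thesis
  proof (cases a)
    case (real r)
    then show ?thesis using \<open>a \<in> U\<close> by blast
  next
    case PInf
    then obtain x where "{ereal x<..} \<subseteq> U"
      using open_PInfty2[OF assms(1)] \<open>a \<in> U\<close> by blast
    moreover have "ereal (x + 1) \<in> {ereal x<..}"
      by simp
    ultimately show ?thesis by blast
  next
    case MInf
    then obtain x where "{..<ereal x} \<subseteq> U"
      using open_MInfty2[OF assms(1)] \<open>a \<in> U\<close> by blast
    moreover have "ereal (x - 1) \<in> {..<ereal x}"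
      by simp
    ultimately show ?thesis by blast
  qed
qed

text \<open>
  A basic open set of the product restricts only finitely many coordinates, and each restriction
  admits a real value; so it contains a family of real numbers with finite support.
\<close>

lemma closure_ell1_in_ereal_fun:
  "closure (range (\<lambda>y j. ereal (apply_ell1 y j))) = (UNIV :: ('j \<Rightarrow> ereal) set)"
proof -
  let ?D = "range (\<lambda>y j. ereal (apply_ell1 y j)) :: ('j \<Rightarrow> ereal) set"
  have meets: "?D \<inter> U \<noteq> {}" if "open U" "a \<in> U"
    for U and a :: "'j \<Rightarrow> ereal"
  proof -
    from that obtain X where X: "a \<in> (\<Pi>\<^sub>E j\<in>UNIV. X j)" "\<And>j. open (X j)"
      "finite {j. X j \<noteq> UNIV}" "(\<Pi>\<^sub>E j\<in>UNIV. X j) \<subseteq> U"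
      using product_topology_open_contains_basis[of "\<lambda>_. euclidean" UNIV U a]
      by (auto simp: open_fun_def)
    have "\<exists>r. ereal r \<in> X j" for j
      using X(1) by (intro open_ereal_contains_real X(2)) auto
    then obtain r where r: "\<And>j. ereal (r j) \<in> X j" by metis
    define y where "y j = (if X j = UNIV then 0 else r j)" for j
    have "(\<lambda>j. \<bar>y j\<bar>) summable_on {j. X j \<noteq> UNIV}"
      using X(3) by (rule summable_on_finite)
    then have "(\<lambda>j. \<bar>y j\<bar>) summable_on UNIV"
      by (rule summable_on_cong_neutral[THEN iffD1, rotated -1]) (auto simp: y_def)
    then have "apply_ell1 (Abs_ell1 y) = y"
      by (simp add: Abs_ell1_inverse)
    moreover have "(\<lambda>j. ereal (y j)) \<in> U"
      using r by (intro subsetD[OF X(4)]) (auto simp: y_def)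
    ultimately have "(\<lambda>j. ereal (apply_ell1 (Abs_ell1 y) j)) \<in> U"
      by simp
    then show ?thesis by blast
  qed
  have "?D \<inter> - closure ?D = {}"
    using closure_subset[of ?D] by blast
  then have "- closure ?D = {}"
    using meets[OF open_Compl[OF closed_closure]] by (metis all_not_in_conv)
  then show ?thesis by blast
qed

theorem theorem3p6:
  assumes "infinite (UNIV :: 'j set)"
  shows "(metric_compactification :: ('j ell1 \<Rightarrow> real) set) =
    {ell1_functional I \<epsilon> z | I \<epsilon> z.
      I \<subseteq> UNIV \<and> \<epsilon> \<in> I \<rightarrow>\<^sub>E {-1, 1} \<and> z \<in> (UNIV - I) \<rightarrow>\<^sub>E UNIV}"
proof -
  let ?D = "range (\<lambda>y j. ereal (apply_ell1 y j)) :: ('j \<Rightarrow> ereal) set"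
  have range_metric: "range metric_functional = extended_functional ` ?D"
    by (auto simp: metric_functional_eq_extended_functional)
  have "compact (range (extended_functional :: ('j \<Rightarrow> ereal) \<Rightarrow> _))"
    by (rule compact_continuous_image[OF continuous_on_extended_functional compact_UNIV_ereal_fun])
  moreover have "Hausdorff_space (euclidean :: ('j ell1 \<Rightarrow> real) topology)"
    by (simp add: Hausdorff_space_product_topology flip: euclidean_product_topology)
  ultimately have "closed (range (extended_functional :: ('j \<Rightarrow> ereal) \<Rightarrow> _))"
    using compactin_imp_closedin by fastforce
  then have "metric_compactification \<subseteq> range (extended_functional :: ('j \<Rightarrow> ereal) \<Rightarrow> _)"
    unfolding metric_compactification_def range_metric by (intro closure_minimal) auto
  moreover have "extended_functional ` closure ?D \<subseteq> closure (extended_functional ` ?D)"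
    by (rule continuous_image_closure_subset[OF continuous_on_extended_functional subset_UNIV])
  then have "range extended_functional \<subseteq> (metric_compactification :: ('j ell1 \<Rightarrow> real) set)"
    unfolding metric_compactification_def range_metric closure_ell1_in_ereal_fun .
  ultimately show ?thesis
    unfolding range_extended_functional[symmetric] by (rule equalityI)
qed

end
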